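(* For every integer $k\ge 1$, $$\mathrm{Rs}(3K_1,k)=\mathrm{Rs}(K_2\cup K_1,k)=\mathrm{Rs}(P_3,k)=4k+1 .$$
   Context: All graphs are finite and simple. $3K_1$ is the edgeless graph on 3 vertices, $K_2\cup K_1$ is an edge plus an isolated vertex, $P_3$ is the path on 3 vertices. For an integer $k\ge1$, a finite multiset of integers, listed as $a_1\le\dots\le a_n$, is $k$-singular if either $a_1=\dots=a_n$ or $a_{j+1}-a_j\ge k$ for every $j=1,\dots,n-1$. A (not necessarily induced) subgraph $H$ of a host graph $F$ is $k$-singular if the multiset of degrees $d_F(v)$, $v\in V(H)$, taken in $F$, is $k$-singular (isolated vertices of $H$ count as vertices). In an edge 2-coloring of $K_m$, the host graph of a color is the spanning graph on all $m$ vertices formed by the edges of that color. $\mathrm{Rs}(G,k)$ is the smallest integer $N$ such that for every $m\ge N$ and every 2-coloring of the edges of $K_m$, at least one of the two color graphs contains a $k$-singular subgraph isomorphic to $G$. *)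

theory Defs
  imports "HOL-Library.Multiset" "HOL-Library.Extended_Nat"
begin

record 'a graph =
  verts :: "'a set"
  edges :: "'a set set"

definition simple_graph :: "'a graph \<Rightarrow> bool" where
  "simple_graph G \<longleftrightarrow>
     finite (verts G) \<and> (\<forall>e\<in>edges G. e \<subseteq> verts G \<and> card e = 2)"

definition subgraph :: "'a graph \<Rightarrow> 'a graph \<Rightarrow> bool" where
  "subgraph H F \<longleftrightarrow>
     simple_graph H \<and> simple_graph F \<and> verts H \<subseteq> verts F \<and> edges H \<subseteq> edges F"

definition isomorphic :: "'a graph \<Rightarrow> 'b graph \<Rightarrow> bool" where
  "isomorphic G H \<longleftrightarrow>
     (\<exists>f. bij_betw f (verts G) (verts H) \<and> edges H = (\<lambda>e. f ` e) ` edges G)"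

definition degree :: "'a graph \<Rightarrow> 'a \<Rightarrow> nat" where
  "degree F v = card {e \<in> edges F. v \<in> e}"

definition singular_mset :: "nat \<Rightarrow> int multiset \<Rightarrow> bool" where
  "singular_mset k A \<longleftrightarrow>
     (let a = sorted_list_of_multiset A in
        (\<forall>i<length a. \<forall>j<length a. a ! i = a ! j) \<or>
        (\<forall>j. j + 1 < length a \<longrightarrow> a ! (j + 1) - a ! j \<ge> int k))"

(* The degrees are those in the host graph F, not those in H. *)
definition singular_in :: "nat \<Rightarrow> 'a graph \<Rightarrow> 'a graph \<Rightarrow> bool" where
  "singular_in k H F \<longleftrightarrow>
     singular_mset k (image_mset (\<lambda>v. int (degree F v)) (mset_set (verts H)))"

definition complete_graph :: "nat \<Rightarrow> nat graph" where
  "complete_graph m = \<lparr>verts = {..<m}, edges = {e. e \<subseteq> {..<m} \<and> card e = 2}\<rparr>"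

(* A 2-coloring is a map c into bool; only its values on the edges of the
   complete graph matter.  The color graph keeps all m vertices. *)
definition color_graph :: "nat \<Rightarrow> (nat set \<Rightarrow> bool) \<Rightarrow> bool \<Rightarrow> nat graph" where
  "color_graph m c b =
     \<lparr>verts = verts (complete_graph m), edges = {e \<in> edges (complete_graph m). c e = b}\<rparr>"

definition singular_arrow :: "'a graph \<Rightarrow> nat \<Rightarrow> nat \<Rightarrow> bool" where
  "singular_arrow G k m \<longleftrightarrow>
     (\<forall>c. \<exists>b H. subgraph H (color_graph m c b) \<and> isomorphic G H \<and>
                singular_in k H (color_graph m c b))"

(* The least N, taken in enat so that the value is infinity if there is no
   such N; a finite value therefore asserts existence as well as minimality. *)
definition Rs :: "'a graph \<Rightarrow> nat \<Rightarrow> enat" where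
  "Rs G k = Inf {enat N | N. \<forall>m\<ge>N. singular_arrow G k m}"

definition three_K1 :: "nat graph" where
  "three_K1 = \<lparr>verts = {0, 1, 2}, edges = {}\<rparr>"

definition K2_Un_K1 :: "nat graph" where
  "K2_Un_K1 = \<lparr>verts = {0, 1, 2}, edges = {{0, 1}}\<rparr>"

definition P3 :: "nat graph" where
  "P3 = \<lparr>verts = {0, 1, 2}, edges = {{0, 1}, {1, 2}}\<rparr>"

end

theory Submission imports Defs begin

text \<open>
  The three graphs have the same number because every three vertices carry a copy of each of
  them: two of the three edges of a triangle have the same colour, and these two form a
  monochromatic path on the three vertices, which contains a spanning copy of each of the three
  graphs. Moreover the degrees of a vertex in the two colours add up to \<open>m - 1\<close>, and reflecting
  a multiset preserves \<open>k\<close>-singularity, so it does not matter which colour the path has. Hence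
  \<open>singular_arrow G k m\<close> says that in every graph on \<open>m\<close> vertices some three vertices have
  \<open>k\<close>-singular degrees (\<open>singular_arrow_iff_triple\<close>).

  If a graph has at least \<open>4 * k + 1\<close> vertices and no three of equal degree, then at least
  \<open>2 * k + 1\<close> distinct degrees occur. Only \<open>2 * k\<close> of them can be closer than \<open>k\<close> to the
  least or to the greatest one, so some degree is at distance at least \<open>k\<close> from both
  (\<open>singular_triple_exists\<close>).

  For \<open>4 * k\<close> vertices the half graph, a bipartite graph with nested neighbourhoods and two sides
  of size \<open>2 * k\<close>, has each of the degrees \<open>1, \<dots>, 2 * k\<close> exactly twice. So no three degrees
  are equal, and no three have gaps of at least \<open>k\<close>, because the greatest and the least degree
  differ by \<open>2 * k - 1\<close> only (\<open>half_graph_no_singular_triple\<close>).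
\<close>

section \<open>Singular triples\<close>

lemma three_set_sorted_by:
  fixes d :: "'a \<Rightarrow> int"
  assumes "card S = 3"
  obtains x y z where "S = {x, y, z}" "distinct [x, y, z]" "d x \<le> d y" "d y \<le> d z"
proof -
  obtain a b c where abc: "S = {a, b, c}" "distinct [a, b, c]"
    using assms by (auto simp: card_3_iff)
  consider "d a \<le> d b \<and> d b \<le> d c" | "d a \<le> d c \<and> d c \<le> d b"
    | "d b \<le> d a \<and> d a \<le> d c" | "d b \<le> d c \<and> d c \<le> d a"
    | "d c \<le> d a \<and> d a \<le> d b" | "d c \<le> d b \<and> d b \<le> d a"
    by linarith
  then show ?thesis
    using abc that[of a b c] that[of a c b] that[of b a c] that[of b c a] that[of c a b] that[of c b a]
    by cases (auto simp: insert_commute)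
qed

lemma singular_mset_triple_iff:
  fixes d :: "'a \<Rightarrow> int"
  assumes "distinct [x, y, z]" and "d x \<le> d y" and "d y \<le> d z"
  shows "singular_mset k (image_mset d (mset_set {x, y, z})) \<longleftrightarrow>
    d x = d z \<or> (d x + int k \<le> d y \<and> d y + int k \<le> d z)"
proof -
  have "image_mset d (mset_set {x, y, z}) = mset [d x, d y, d z]"
    using assms(1) by simp
  then have "sorted_list_of_multiset (image_mset d (mset_set {x, y, z})) = [d x, d y, d z]"
    using assms(2,3) by (metis sorted_list_of_multiset_mset sorted_sort_id sorted2 sorted1)
  then show ?thesis
    using assms(2,3)
    by (auto simp: singular_mset_def Let_def numeral_3_eq_3 less_Suc_eq all_conj_distrib)
qed

lemma singular_mset_reflect_triple:
  fixes d :: "'a \<Rightarrow> int"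
  assumes "card S = 3"
  shows "singular_mset k (image_mset (\<lambda>v. C - d v) (mset_set S)) \<longleftrightarrow>
    singular_mset k (image_mset d (mset_set S))"
proof -
  obtain x y z where S: "S = {x, y, z}" and xyz: "distinct [x, y, z]" "d x \<le> d y" "d y \<le> d z"
    using assms by (rule three_set_sorted_by)
  have S': "S = {z, y, x}"
    using S by auto
  have "singular_mset k (image_mset (\<lambda>v. C - d v) (mset_set S)) \<longleftrightarrow>
      C - d z = C - d x \<or> (C - d z + int k \<le> C - d y \<and> C - d y + int k \<le> C - d x)"
    unfolding S' by (rule singular_mset_triple_iff) (use xyz in auto)
  also have "\<dots> \<longleftrightarrow> singular_mset k (image_mset d (mset_set S))"
    unfolding S singular_mset_triple_iff[OF xyz] by auto
  finally show ?thesis .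
qed

text \<open>
  If every value is taken at most twice, there are more than \<open>2 * k\<close> values, too many for the
  \<open>k\<close> lowest and the \<open>k\<close> highest places between the minimum and the maximum. The triple then
  consists of points where the minimum, the maximum and a value away from both are attained.
\<close>
lemma singular_triple_exists:
  fixes d :: "'a \<Rightarrow> int"
  assumes "k \<ge> 1" and "finite V" and "card V \<ge> 4 * k + 1"
  shows "\<exists>S\<subseteq>V. card S = 3 \<and> singular_mset k (image_mset d (mset_set S))"
proof (cases "\<exists>t. card {v \<in> V. d v = t} \<ge> 3")
  case True
  then obtain t S where S: "S \<subseteq> {v \<in> V. d v = t}" "card S = 3"
    by (meson obtain_subset_with_card_n)
  obtain x y z where xyz: "S = {x, y, z}" "distinct [x, y, z]" "d x \<le> d y" "d y \<le> d z"
    using S(2) by (rule three_set_sorted_by)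
  have "d x = d z"
    using S(1) xyz(1) by auto
  then have "singular_mset k (image_mset d (mset_set S))"
    unfolding xyz(1) singular_mset_triple_iff[OF xyz(2-4)] by simp
  then show ?thesis
    using S by blast
next
  case False
  define D where "D = d ` V"
  have "finite D"
    using assms(2) by (simp add: D_def)
  have "D \<noteq> {}"
    using assms(3) by (auto simp: D_def)
  have "card V = card (\<Union>t\<in>D. {v \<in> V. d v = t})"
    by (rule arg_cong[of _ _ card]) (auto simp: D_def)
  also have "\<dots> \<le> (\<Sum>t\<in>D. card {v \<in> V. d v = t})"
    using \<open>finite D\<close> by (rule card_UN_le)
  also have "\<dots> \<le> (\<Sum>t\<in>D. 2)"
    using False by (intro sum_mono) (metis not_less_eq_eq numeral_2_eq_2 numeral_3_eq_3)
  finally have "card D > 2 * k"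
    using assms(3) by simp
  have "\<exists>c\<in>D. Min D + int k \<le> c \<and> c + int k \<le> Max D"
  proof (rule ccontr)
    assume no_middle: "\<not> ?thesis"
    have "D \<subseteq> {Min D ..< Min D + int k} \<union> {Max D - int k <.. Max D}"
    proof
      fix c
      assume "c \<in> D"
      moreover have "Min D \<le> c" "c \<le> Max D"
        using \<open>c \<in> D\<close> \<open>finite D\<close> by auto
      ultimately show "c \<in> {Min D ..< Min D + int k} \<union> {Max D - int k <.. Max D}"
        using no_middle by force
    qed
    then have "card D \<le> card ({Min D ..< Min D + int k} \<union> {Max D - int k <.. Max D})"
      by (intro card_mono) auto
    also have "\<dots> \<le> card {Min D ..< Min D + int k} + card {Max D - int k <.. Max D}"
      by (rule card_Un_le)
    also have "\<dots> = 2 * k"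
      by simp
    finally show False
      using \<open>card D > 2 * k\<close> by simp
  qed
  moreover have "Min D \<in> D" "Max D \<in> D"
    using \<open>finite D\<close> \<open>D \<noteq> {}\<close> by auto
  ultimately obtain x y z where xyz: "x \<in> V" "y \<in> V" "z \<in> V"
      "d x + int k \<le> d y" "d y + int k \<le> d z"
    unfolding D_def by (metis imageE)
  then have "d x < d y" "d y < d z"
    using assms(1) by auto
  then have dist: "distinct [x, y, z]"
    by auto
  then have "singular_mset k (image_mset d (mset_set {x, y, z}))"
    using xyz \<open>d x < d y\<close> \<open>d y < d z\<close> by (subst singular_mset_triple_iff) auto
  moreover have "card {x, y, z} = 3"
    using dist by simp
  ultimately show ?thesis
    using xyz(1-3) by (intro exI[of _ "{x, y, z}"]) auto
qed

section \<open>Degrees in the two colours\<close>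

lemma degree_color_graph:
  assumes "v < m"
  shows "degree (color_graph m c b) v = card {w. w < m \<and> w \<noteq> v \<and> c {v, w} = b}"
proof -
  have "bij_betw (\<lambda>w. {v, w}) {w. w < m \<and> w \<noteq> v \<and> c {v, w} = b}
      {e \<in> edges (color_graph m c b). v \<in> e}"
    unfolding bij_betw_def
  proof
    show "inj_on (\<lambda>w. {v, w}) {w. w < m \<and> w \<noteq> v \<and> c {v, w} = b}"
      by (auto simp: inj_on_def doubleton_eq_iff)
    show "(\<lambda>w. {v, w}) ` {w. w < m \<and> w \<noteq> v \<and> c {v, w} = b} =
        {e \<in> edges (color_graph m c b). v \<in> e}" (is "?L = ?R")
    proof
      show "?L \<subseteq> ?R"
        using assms by (auto simp: color_graph_def complete_graph_def)
      show "?R \<subseteq> ?L"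
        by (auto simp: color_graph_def complete_graph_def card_2_iff insert_commute)
    qed
  qed
  from bij_betw_same_card[OF this] show ?thesis
    unfolding degree_def by simp
qed

lemma degree_opposite_color:
  assumes "v < m"
  shows "int (degree (color_graph m c (\<not> b)) v) =
    (int m - 1) - int (degree (color_graph m c b) v)"
proof -
  have "card {w. w < m \<and> w \<noteq> v \<and> c {v, w} = b} + card {w. w < m \<and> w \<noteq> v \<and> c {v, w} = (\<not> b)}
      = card ({w. w < m \<and> w \<noteq> v \<and> c {v, w} = b} \<union> {w. w < m \<and> w \<noteq> v \<and> c {v, w} = (\<not> b)})"
    by (rule card_Un_disjoint[symmetric]) auto
  also have "\<dots> = card ({..<m} - {v})"
    by (rule arg_cong[of _ _ card]) auto
  also have "\<dots> = m - 1"
    using assms by simp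
  finally show ?thesis
    using assms by (simp add: degree_color_graph)
qed

text \<open>
  Passing to the other colour reflects the degrees, so a triple that is found by looking at one
  colour can be used in whichever colour carries the monochromatic path.
\<close>
lemma singular_triple_color_independent:
  assumes "S \<subseteq> {..<m}" and "card S = 3"
  shows "singular_mset k (image_mset (\<lambda>v. int (degree (color_graph m c b) v)) (mset_set S)) \<longleftrightarrow>
    singular_mset k (image_mset (\<lambda>v. int (degree (color_graph m c True) v)) (mset_set S))"
proof (cases b)
  case False
  have "finite S"
    using finite_subset[OF assms(1)] by simp
  have "int (degree (color_graph m c b) v) =
      (int m - 1) - int (degree (color_graph m c True) v)" if "v \<in> S" for v
    using degree_opposite_color[of v m c True] that assms(1) False by auto
  then have "image_mset (\<lambda>v. int (degree (color_graph m c b) v)) (mset_set S) =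
      image_mset (\<lambda>v. (int m - 1) - int (degree (color_graph m c True) v)) (mset_set S)"
    using \<open>finite S\<close> by (intro image_mset_cong) simp
  then show ?thesis
    by (simp only: singular_mset_reflect_triple[OF assms(2)])
qed simp

section \<open>Reduction to degrees of triples\<close>

text \<open>
  Two of the three edges inside \<open>S\<close> share a colour, and their common vertex becomes the middle
  of the path. The assumptions say that \<open>G\<close> is a spanning subgraph of the path, which covers all
  three graphs at once.
\<close>
lemma monochromatic_copy_on_triple:
  assumes "verts G = verts P3" and "edges G \<subseteq> edges P3"
    and "S \<subseteq> {..<m}" and "card S = 3"
  obtains b H where "subgraph H (color_graph m c b)" "isomorphic G H" "verts H = S"
proof -
  obtain p q r where pqr: "S = {p, q, r}" "distinct [p, q, r]"
    using assms(4) by (auto simp: card_3_iff)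
  consider "c {p, q} = c {q, r}" | "c {q, p} = c {p, r}" | "c {p, r} = c {r, q}"
    by (cases "c {p, q}"; cases "c {q, r}"; cases "c {p, r}") (auto simp: insert_commute)
  then obtain x y z where S: "S = {x, y, z}" and dist: "distinct [x, y, z]"
      and col: "c {x, y} = c {y, z}"
  proof cases
    case 1
    with pqr show ?thesis by (intro that[of p q r]) auto
  next
    case 2
    with pqr show ?thesis by (intro that[of q p r]) auto
  next
    case 3
    with pqr show ?thesis by (intro that[of p r q]) auto
  qed
  define f where "f = (\<lambda>i::nat. if i = 0 then x else if i = 1 then y else z)"
  define H where "H = \<lparr>verts = S, edges = (\<lambda>e. f ` e) ` edges G\<rparr>"
  have edges_H: "e = {x, y} \<or> e = {y, z}" if e: "e \<in> edges H" for e
  proof -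
    obtain e' where "e' \<in> edges P3" "e = f ` e'"
      using e assms(2) by (auto simp: H_def)
    then show ?thesis
      by (auto simp: P3_def f_def)
  qed
  have "e \<subseteq> S \<and> card e = 2 \<and> c e = c {x, y}" if "e \<in> edges H" for e
    using edges_H[OF that] S dist col by auto
  then have "subgraph H (color_graph m c (c {x, y}))"
    unfolding subgraph_def simple_graph_def color_graph_def complete_graph_def
    using S assms(3) by (auto simp: H_def)
  moreover have "bij_betw f (verts G) (verts H)"
    using assms(1) S dist by (auto simp: bij_betw_def inj_on_def H_def P3_def f_def)
  then have "isomorphic G H"
    unfolding isomorphic_def by (auto simp: H_def)
  moreover have "verts H = S"
    by (simp add: H_def)
  ultimately show ?thesis
    by (rule that)
qed

lemma singular_arrow_iff_triple:
  assumes "verts G = verts P3" and "edges G \<subseteq> edges P3"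
  shows "singular_arrow G k m \<longleftrightarrow> (\<forall>c. \<exists>S\<subseteq>{..<m}. card S = 3 \<and>
    singular_mset k (image_mset (\<lambda>v. int (degree (color_graph m c True) v)) (mset_set S)))"
    (is "_ \<longleftrightarrow> (\<forall>c. \<exists>S\<subseteq>_. _ \<and> ?sing c S)")
proof
  assume arrow: "singular_arrow G k m"
  show "\<forall>c. \<exists>S\<subseteq>{..<m}. card S = 3 \<and> ?sing c S"
  proof
    fix c
    obtain b H where H: "subgraph H (color_graph m c b)" "isomorphic G H"
        "singular_in k H (color_graph m c b)"
      using arrow unfolding singular_arrow_def by blast
    have sub: "verts H \<subseteq> {..<m}"
      using H(1) by (auto simp: subgraph_def color_graph_def complete_graph_def)
    have "card (verts H) = card (verts G)"
      using H(2) unfolding isomorphic_def by (auto dest: bij_betw_same_card)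
    then have three: "card (verts H) = 3"
      by (simp add: assms(1) P3_def)
    have "?sing c (verts H)"
      using H(3) singular_triple_color_independent[OF sub three, of k c b]
      unfolding singular_in_def by blast
    then show "\<exists>S\<subseteq>{..<m}. card S = 3 \<and> ?sing c S"
      using sub three by (intro exI[of _ "verts H"] conjI)
  qed
next
  assume triple: "\<forall>c. \<exists>S\<subseteq>{..<m}. card S = 3 \<and> ?sing c S"
  show "singular_arrow G k m"
    unfolding singular_arrow_def
  proof
    fix c
    obtain S where S: "S \<subseteq> {..<m}" "card S = 3" "?sing c S"
      using triple by blast
    obtain b H where H: "subgraph H (color_graph m c b)" "isomorphic G H" "verts H = S"
      using assms S(1,2) by (rule monochromatic_copy_on_triple)
    have "singular_in k H (color_graph m c b)"
      using S(3) singular_triple_color_independent[OF S(1,2), of k c b]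
      unfolding singular_in_def H(3) by blast
    then show "\<exists>b H. subgraph H (color_graph m c b) \<and> isomorphic G H \<and>
        singular_in k H (color_graph m c b)"
      using H by blast
  qed
qed

section \<open>The half graph\<close>

text \<open>
  On the vertices \<open>{..<2 * n}\<close> this colours the half graph: each side \<open>{..<n}\<close>, \<open>{n..<2 * n}\<close>
  has nested intervals as neighbourhoods, so that its \<open>n\<close> degrees are all different.
\<close>
definition half_graph_coloring :: "nat \<Rightarrow> nat set \<Rightarrow> bool" where
  "half_graph_coloring n e \<longleftrightarrow> (\<exists>u w. e = {u, w} \<and> u < n \<and> n \<le> w \<and> w \<le> n + u)"

lemma half_graph_coloring_pair_iff:
  "half_graph_coloring n {u, w} \<longleftrightarrow>
    (u < n \<and> n \<le> w \<and> w \<le> n + u) \<or> (w < n \<and> n \<le> u \<and> u \<le> n + w)"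
  unfolding half_graph_coloring_def doubleton_eq_iff
  by (simp add: conj_disj_distribR ex_disj_distrib)

lemma degree_half_graph:
  assumes "v < 2 * n"
  shows "degree (color_graph (2 * n) (half_graph_coloring n) True) v =
    (if v < n then v + 1 else 2 * n - v)"
proof (cases "v < n")
  case True
  then have "{w. w < 2 * n \<and> w \<noteq> v \<and> half_graph_coloring n {v, w} = True} = {n..n + v}"
    by (auto simp: half_graph_coloring_pair_iff)
  then show ?thesis
    using True assms by (simp add: degree_color_graph)
next
  case False
  then have "{w. w < 2 * n \<and> w \<noteq> v \<and> half_graph_coloring n {v, w} = True} = {v - n..<n}"
    using assms by (auto simp: half_graph_coloring_pair_iff)
  then show ?thesis
    using False assms by (simp add: degree_color_graph)
qed

lemma half_graph_no_singular_triple: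
  assumes "S \<subseteq> {..<4 * k}" and "card S = 3"
  shows "\<not> singular_mset k (image_mset
    (\<lambda>v. int (degree (color_graph (4 * k) (half_graph_coloring (2 * k)) True) v)) (mset_set S))"
proof -
  define d where
    "d v = int (degree (color_graph (4 * k) (half_graph_coloring (2 * k)) True) v)" for v
  have d: "d v = (if v < 2 * k then int v + 1 else int (4 * k) - int v)" if "v < 4 * k" for v
    using degree_half_graph[of v "2 * k"] that by (simp add: d_def)
  obtain x y z where S: "S = {x, y, z}" and xyz: "distinct [x, y, z]" "d x \<le> d y" "d y \<le> d z"
    using assms(2) by (rule three_set_sorted_by)
  have lt: "x < 4 * k" "y < 4 * k" "z < 4 * k"
    using assms(1) S by auto
  have "d x \<noteq> d z"
  proof
    \<comment> \<open>Two vertices of equal degree lie on different sides.\<close>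
    assume "d x = d z"
    then have "d x = d y" "d y = d z"
      using xyz(2,3) by auto
    then show False
      using xyz(1) unfolding d[OF lt(1)] d[OF lt(2)] d[OF lt(3)] by (auto split: if_splits)
  qed
  moreover have "1 \<le> d x" "d z \<le> 2 * int k"
    using lt d[of x] d[of z] by auto
  ultimately have "\<not> singular_mset k (image_mset d (mset_set S))"
    unfolding S singular_mset_triple_iff[OF xyz] by linarith
  then show ?thesis
    unfolding d_def .
qed

section \<open>The three Ramsey numbers\<close>

lemma Rs_spanning_subgraph_of_P3:
  assumes "k \<ge> 1" and "verts G = verts P3" and "edges G \<subseteq> edges P3"
  shows "Rs G k = enat (4 * k + 1)"
proof -
  have upper: "singular_arrow G k m" if "m \<ge> 4 * k + 1" for m
    unfolding singular_arrow_iff_triple[OF assms(2,3)]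
    using singular_triple_exists[OF assms(1), of "{..<m}"] that by simp
  have "\<not> singular_arrow G k (4 * k)"
    unfolding singular_arrow_iff_triple[OF assms(2,3)]
    using half_graph_no_singular_triple by blast
  then have lower: "4 * k + 1 \<le> N" if "\<forall>m\<ge>N. singular_arrow G k m" for N
    using that by (metis Suc_eq_plus1 not_less_eq_eq)
  show ?thesis
    unfolding Rs_def
  proof (rule antisym)
    show "Inf {enat N |N. \<forall>m\<ge>N. singular_arrow G k m} \<le> enat (4 * k + 1)"
      using upper by (intro Inf_lower) blast
    show "enat (4 * k + 1) \<le> Inf {enat N |N. \<forall>m\<ge>N. singular_arrow G k m}"
      using lower by (intro Inf_greatest) auto
  qed
qed

theorem theorem25:
  fixes k :: nat
  assumes "k \<ge> 1"
  shows "Rs three_K1 k = enat (4 * k + 1) \<and>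
         Rs K2_Un_K1 k = enat (4 * k + 1) \<and>
         Rs P3 k = enat (4 * k + 1)"
  using assms
  by (intro conjI Rs_spanning_subgraph_of_P3) (auto simp: three_K1_def K2_Un_K1_def P3_def)

end
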